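(* $k_0(c_0) \ge 4$.
   Context: $c_0$ is the Banach space of real sequences $x=(x_n)_{n\ge1}$ converging to $0$, with the norm $\|x\|=\sup_n|x_n|$. For a Banach space $X$, $B_X=\{x\in X:\|x\|\le 1\}$ denotes the (closed) unit ball and $S_X=\{x\in X:\|x\|=1\}$ the unit sphere. A retraction $R:B_X\to S_X$ is a map with $R(x)=x$ for all $x\in S_X$; it is $k$-Lipschitz if $\|R(x)-R(y)\|\le k\|x-y\|$ for all $x,y\in B_X$. For an infinite-dimensional Banach space $X$, $$k_0(X) := \inf\{k>0 : \text{there exists a } k\text{-Lipschitz retraction } R:B_X\to S_X\}.$$ *)

theory Defs
  imports "HOL-Analysis.Analysis"
begin

text \<open>Null sequences are indexed from 0 instead of 1, which only relabels the coordinates.\<close>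

typedef c0 = "{x :: nat \<Rightarrow> real. x \<longlonglongrightarrow> 0}"
  morphisms c0_nth Abs_c0
  by (rule exI[of _ "\<lambda>_. 0"]) simp

setup_lifting type_definition_c0

lemma c0_nth_tendsto: "c0_nth x \<longlonglongrightarrow> 0"
  using c0_nth[of x] by simp

lemma c0_eqI: "(\<And>n. c0_nth x n = c0_nth y n) \<Longrightarrow> x = y"
  by (simp add: c0_nth_inject[symmetric] fun_eq_iff)

lemma c0_bdd_above: "bdd_above (range (\<lambda>n. \<bar>c0_nth x n\<bar>))"
proof -
  have "Bseq (c0_nth x)"
    using c0_nth_tendsto convergentI convergent_imp_Bseq by blast
  then obtain K where "\<And>n. norm (c0_nth x n) \<le> K" by (auto simp: Bseq_def)
  then show ?thesis by (intro bdd_aboveI[of _ K]) auto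
qed

instantiation c0 :: real_normed_vector
begin

lift_definition zero_c0 :: c0 is "\<lambda>_. 0" by simp
lift_definition plus_c0 :: "c0 \<Rightarrow> c0 \<Rightarrow> c0" is "\<lambda>x y n. x n + y n"
  by (rule tendsto_add_zero)
lift_definition minus_c0 :: "c0 \<Rightarrow> c0 \<Rightarrow> c0" is "\<lambda>x y n. x n - y n"
  using tendsto_diff by fastforce
lift_definition uminus_c0 :: "c0 \<Rightarrow> c0" is "\<lambda>x n. - x n"
  using tendsto_minus by fastforce
lift_definition scaleR_c0 :: "real \<Rightarrow> c0 \<Rightarrow> c0" is "\<lambda>r x n. r * x n"
  by (rule tendsto_mult_right_zero)

definition norm_c0 :: "c0 \<Rightarrow> real"
  where "norm_c0 x = (SUP n. \<bar>c0_nth x n\<bar>)"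

definition dist_c0 :: "c0 \<Rightarrow> c0 \<Rightarrow> real"
  where "dist_c0 x y = norm (x - y)"

definition sgn_c0 :: "c0 \<Rightarrow> c0"
  where "sgn_c0 x = inverse (norm x) *\<^sub>R x"

definition uniformity_c0 :: "(c0 \<times> c0) filter"
  where "uniformity_c0 = (INF e\<in>{0 <..}. principal {(x, y). dist x y < e})"

definition open_c0 :: "c0 set \<Rightarrow> bool"
  where "open_c0 U = (\<forall>x\<in>U. \<forall>\<^sub>F (x', y) in uniformity. x' = x \<longrightarrow> y \<in> U)"

lemma abs_c0_nth_le_norm: "\<bar>c0_nth x n\<bar> \<le> norm x"
  unfolding norm_c0_def by (rule cSUP_upper[OF UNIV_I c0_bdd_above])

lemma norm_c0_le: "(\<And>n. \<bar>c0_nth x n\<bar> \<le> B) \<Longrightarrow> norm (x :: c0) \<le> B"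
  unfolding norm_c0_def by (rule cSUP_least) auto

instance
proof
  fix x y z :: c0 and a b :: real
  show "x + y + z = x + (y + z)" by transfer (simp add: add.assoc)
  show "x + y = y + x" by transfer (simp add: add.commute)
  show "0 + x = x" by transfer simp
  show "- x + x = 0" by transfer simp
  show "x - y = x + - y" by transfer simp
  show "a *\<^sub>R (x + y) = a *\<^sub>R x + a *\<^sub>R y" by transfer (simp add: algebra_simps)
  show "(a + b) *\<^sub>R x = a *\<^sub>R x + b *\<^sub>R x" by transfer (simp add: algebra_simps)
  show "a *\<^sub>R b *\<^sub>R x = (a * b) *\<^sub>R x" by transfer (simp add: mult.assoc)
  show "1 *\<^sub>R x = x" by transfer simp
  show "dist x y = norm (x - y)" by (rule dist_c0_def)
  show "sgn x = inverse (norm x) *\<^sub>R x" by (rule sgn_c0_def)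
  show "uniformity = (INF e\<in>{0 <..}. principal {(x :: c0, y). dist x y < e})"
    by (rule uniformity_c0_def)
  show "open U = (\<forall>x\<in>U. \<forall>\<^sub>F (x', y) in uniformity. x' = x \<longrightarrow> y \<in> U)" for U :: "c0 set"
    by (rule open_c0_def)
  show "norm x = 0 \<longleftrightarrow> x = 0"
  proof
    assume "norm x = 0"
    then have "c0_nth x n = 0" for n using abs_c0_nth_le_norm[of x n] by simp
    then show "x = 0" by (intro c0_eqI) (simp add: zero_c0.rep_eq)
  next
    assume "x = 0"
    then show "norm x = 0" by (simp add: norm_c0_def zero_c0.rep_eq)
  qed
  show "norm (x + y) \<le> norm x + norm y"
  proof (rule norm_c0_le)
    fix n
    show "\<bar>c0_nth (x + y) n\<bar> \<le> norm x + norm y"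
      using abs_c0_nth_le_norm[of x n] abs_c0_nth_le_norm[of y n]
      by (simp add: plus_c0.rep_eq)
  qed
  have le: "norm (c *\<^sub>R w) \<le> \<bar>c\<bar> * norm w" for c and w :: c0
    by (rule norm_c0_le)
      (simp add: scaleR_c0.rep_eq abs_mult mult_left_mono abs_c0_nth_le_norm)
  show "norm (a *\<^sub>R x) = \<bar>a\<bar> * norm x"
  proof (cases "a = 0")
    case True
    then show ?thesis
      by (simp add: norm_c0_def scaleR_c0.rep_eq)
  next
    case False
    have "norm (inverse a *\<^sub>R a *\<^sub>R x) \<le> \<bar>inverse a\<bar> * norm (a *\<^sub>R x)" by (rule le)
    moreover have "inverse a *\<^sub>R a *\<^sub>R x = x" using False by transfer (simp add: mult.assoc[symmetric])
    ultimately have "\<bar>a\<bar> * norm x \<le> norm (a *\<^sub>R x)" using False by (simp add: field_simps)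
    with le[of a x] show ?thesis by simp
  qed
qed

end

instance c0 :: banach
proof
  fix X :: "nat \<Rightarrow> c0"
  assume X: "Cauchy X"
  have nth_le: "\<bar>c0_nth x n - c0_nth y n\<bar> \<le> dist x y" for x y n
    using abs_c0_nth_le_norm[of "x - y" n] by (simp add: dist_norm minus_c0.rep_eq)
  have "Cauchy (\<lambda>k. c0_nth (X k) n)" for n
  proof (rule metric_CauchyI)
    fix e :: real assume "0 < e"
    then obtain M where "\<forall>j\<ge>M. \<forall>k\<ge>M. dist (X j) (X k) < e" using X metric_CauchyD by blast
    then show "\<exists>M. \<forall>j\<ge>M. \<forall>k\<ge>M. dist (c0_nth (X j) n) (c0_nth (X k) n) < e"
      using nth_le by (metis dist_real_def le_less_trans)
  qed
  then have "\<exists>l. (\<lambda>k. c0_nth (X k) n) \<longlonglongrightarrow> l" for n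
    using Cauchy_convergent convergent_def by blast
  then obtain l where l: "\<And>n. (\<lambda>k. c0_nth (X k) n) \<longlonglongrightarrow> l n" by metis
  have unif: "\<exists>M. \<forall>k\<ge>M. \<forall>n. \<bar>c0_nth (X k) n - l n\<bar> \<le> e" if "0 < e" for e :: real
  proof -
    obtain M where M: "\<forall>j\<ge>M. \<forall>k\<ge>M. dist (X j) (X k) < e" using X \<open>0 < e\<close> metric_CauchyD by blast
    have "\<bar>c0_nth (X k) n - l n\<bar> \<le> e" if "k \<ge> M" for k n
    proof (rule tendsto_upperbound)
      show "(\<lambda>j. \<bar>c0_nth (X k) n - c0_nth (X j) n\<bar>) \<longlonglongrightarrow> \<bar>c0_nth (X k) n - l n\<bar>"
        by (intro tendsto_intros l)
      show "\<forall>\<^sub>F j in sequentially. \<bar>c0_nth (X k) n - c0_nth (X j) n\<bar> \<le> e"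
        using eventually_ge_at_top[of M]
      proof eventually_elim
        case (elim j)
        then show ?case using nth_le[of "X k" n "X j"] M that by force
      qed
    qed simp
    then show ?thesis by blast
  qed
  have "l \<longlonglongrightarrow> 0"
  proof (rule LIMSEQ_I)
    fix e :: real assume "0 < e"
    then obtain M where M: "\<And>n. \<bar>c0_nth (X M) n - l n\<bar> \<le> e / 2"
      using unif[of "e / 2"] by auto
    obtain N where "\<And>n. n \<ge> N \<Longrightarrow> \<bar>c0_nth (X M) n\<bar> < e / 2"
      using LIMSEQ_D[OF c0_nth_tendsto[of "X M"], of "e / 2"] \<open>0 < e\<close> by auto
    then have "norm (l n - 0) < e" if "n \<ge> N" for n
      using M[of n] that by (smt (verit) field_sum_of_halves real_norm_def)
    then show "\<exists>N. \<forall>n\<ge>N. norm (l n - 0) < e" by blast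
  qed
  then have nth_L: "c0_nth (Abs_c0 l) = l" by (simp add: Abs_c0_inverse)
  have "X \<longlonglongrightarrow> Abs_c0 l"
  proof (rule metric_LIMSEQ_I)
    fix e :: real assume "0 < e"
    then obtain M where M: "\<forall>k\<ge>M. \<forall>n. \<bar>c0_nth (X k) n - l n\<bar> \<le> e / 2"
      using unif[of "e / 2"] by auto
    have "dist (X k) (Abs_c0 l) < e" if "k \<ge> M" for k
    proof -
      have "norm (X k - Abs_c0 l) \<le> e / 2"
        by (rule norm_c0_le) (use M that in \<open>simp add: minus_c0.rep_eq nth_L\<close>)
      then show ?thesis using \<open>0 < e\<close> by (simp add: dist_norm)
    qed
    then show "\<exists>M. \<forall>k\<ge>M. dist (X k) (Abs_c0 l) < e" by blast
  qed
  then show "convergent X" by (rule convergentI)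
qed

text \<open>
  The space is passed as a type. The infimum is taken in the extended reals, so that it is
  \<open>\<infinity>\<close> if there is no Lipschitz retraction at all; over \<^typ>\<open>real\<close> the infimum
  of the empty set is an unspecified number. Continuity, which is part of \<^const>\<open>retraction\<close>,
  is implied by the Lipschitz condition.
\<close>

definition k0 :: "'a::banach itself \<Rightarrow> ereal"
  where "k0 _ = Inf {ereal k | k. 0 < k \<and>
    (\<exists>R :: 'a \<Rightarrow> 'a. retraction (cball 0 1) (sphere 0 1) R \<and> k-lipschitz_on (cball 0 1) R)}"

end

theory Submission
  imports Defs
begin

text \<open>
  Suppose that \<open>R\<close> is a \<open>k\<close>-Lipschitz retraction of the unit ball of \<^typ>\<open>c0\<close> onto its
  sphere and that \<open>k < 4\<close>. The map \<open>-R/4\<close> is then a contraction of the ball, so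
  \<open>x = -R x / 4\<close> for some \<open>x\<close>. Since \<open>R x\<close> is a null sequence of norm \<open>1\<close>, some coordinate
  \<open>i\<close> has \<open>(R x)\<^sub>i = s\<close> with \<open>\<bar>s\<bar> = 1\<close>. Hence \<open>x\<^sub>i = -s/4\<close>, whereas all coordinates of \<open>x\<close>
  have modulus at most \<open>1/4\<close>.

  Let \<open>y\<close> be \<open>x\<close> with its coordinate \<open>i\<close> replaced by \<open>-3s/4\<close>. This point is close to two
  points at which \<open>R\<close> is known. It lies within \<open>1/4\<close> of \<open>-s e\<^sub>i\<close>, which \<open>R\<close> fixes, so
  \<open>R y\<close> differs from \<open>-s e\<^sub>i\<close> by less than \<open>1\<close>; as \<open>R y\<close> attains its norm \<open>1\<close> at some
  coordinate, this is possible only if \<open>(R y)\<^sub>i = -s\<close>. On the other hand, \<open>y\<close> lies within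
  \<open>1/2\<close> of \<open>x\<close>, where \<open>(R x)\<^sub>i = s\<close>. Thus \<open>2 \<le> k/2\<close>, a contradiction.

  The supremum norm enters in two ways: the other coordinates of \<open>x\<close> do not add to the
  distance of \<open>y\<close> from \<open>-s e\<^sub>i\<close>, and a sequence at distance less than \<open>1\<close> from a signed
  unit vector can have norm \<open>1\<close> only through that coordinate.
\<close>

lemma c0_norm_attained: "\<exists>i. \<bar>c0_nth x i\<bar> = norm x"
proof (cases "x = 0")
  case True
  then show ?thesis by (simp add: zero_c0.rep_eq)
next
  case False
  then have pos: "0 < norm x" by simp
  \<comment> \<open>From \<open>N\<close> on the entries stay below half the norm, so the supremum is the maximum of
    the entries before \<open>N\<close>.\<close>
  obtain N where N: "\<And>n. n \<ge> N \<Longrightarrow> \<bar>c0_nth x n\<bar> < norm x / 2"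
    using LIMSEQ_D[OF c0_nth_tendsto[of x], of "norm x / 2"] pos by auto
  define m where "m = Max (insert (norm x / 2) ((\<lambda>n. \<bar>c0_nth x n\<bar>) ` {..<N}))"
  have m_ge: "\<bar>c0_nth x n\<bar> \<le> m" for n
  proof (cases "n < N")
    case True
    then show ?thesis unfolding m_def by (intro Max_ge) auto
  next
    case False
    have "norm x / 2 \<le> m" unfolding m_def by (intro Max_ge) auto
    with N[of n] False show ?thesis by simp
  qed
  then have "norm x \<le> m" by (rule norm_c0_le)
  have "m \<in> insert (norm x / 2) ((\<lambda>n. \<bar>c0_nth x n\<bar>) ` {..<N})"
    unfolding m_def by (intro Max_in) auto
  moreover have "m \<noteq> norm x / 2" using \<open>norm x \<le> m\<close> pos by linarith
  ultimately obtain n where "m = \<bar>c0_nth x n\<bar>" by auto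
  with \<open>norm x \<le> m\<close> abs_c0_nth_le_norm[of x n] show ?thesis by (intro exI[of _ n]) simp
qed

lift_definition c0_upd :: "c0 \<Rightarrow> nat \<Rightarrow> real \<Rightarrow> c0" is "\<lambda>x i a. x(i := a)"
proof -
  fix x :: "nat \<Rightarrow> real" and i a
  assume x: "x \<longlonglongrightarrow> 0"
  have "\<forall>\<^sub>F n in sequentially. x n = (x(i := a)) n"
    using eventually_gt_at_top[of i] by eventually_elim simp
  with x show "x(i := a) \<longlonglongrightarrow> 0" by (rule Lim_transform_eventually)
qed

lemma dist_c0_leI:
  "(\<And>n. \<bar>c0_nth x n - c0_nth y n\<bar> \<le> B) \<Longrightarrow> dist x y \<le> B"
  unfolding dist_norm by (rule norm_c0_le) (simp add: minus_c0.rep_eq)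

lemma abs_c0_nth_diff_le_dist: "\<bar>c0_nth x n - c0_nth y n\<bar> \<le> dist x y"
  using abs_c0_nth_le_norm[of "x - y" n] by (simp add: dist_norm minus_c0.rep_eq)

lemma norm_1_near_signed_unit_vector:
  assumes s: "\<bar>s\<bar> = 1" and norm: "norm w = 1" and near: "dist w (c0_upd 0 i s) < 1"
  shows "c0_nth w i = s"
proof -
  obtain j where j: "\<bar>c0_nth w j\<bar> = 1" using c0_norm_attained[of w] norm by auto
  have diff: "\<bar>c0_nth w j - c0_nth (c0_upd 0 i s) j\<bar> < 1"
    using abs_c0_nth_diff_le_dist near by (rule le_less_trans)
  with j have "j = i" by (auto simp: c0_upd.rep_eq zero_c0.rep_eq split: if_splits)
  with j diff s show ?thesis by (simp add: c0_upd.rep_eq abs_if split: if_splits)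
qed

text \<open>
  The factor \<open>-1/4\<close> is what makes the two estimates meet at \<open>4\<close>. With \<open>-t\<close> in its place
  the contraction and the comparison with the unit vector both need \<open>k t < 1\<close>, and the final
  comparison gives \<open>2 \<le> k \<bar>1 - 2 t\<bar>\<close>; for every \<open>k < 4\<close> the choice \<open>t = 1/4\<close> meets the
  former condition and violates the latter.
\<close>

lemma lipschitz_retraction_c0_ge_4:
  fixes R :: "c0 \<Rightarrow> c0"
  assumes ret: "retraction (cball 0 1) (sphere 0 1) R"
    and lip: "k-lipschitz_on (cball 0 1) R"
  shows "4 \<le> k"
proof (rule ccontr)
  assume "\<not> 4 \<le> k"
  then have k4: "k < 4" by simp
  have k0: "0 \<le> k" using lip by (rule lipschitz_on_nonneg)
  have norm_R: "norm (R x) = 1" if "norm x \<le> 1" for x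
    using ret that by (auto simp: retraction_def image_subset_iff Pi_iff)
  have R_fix: "R z = z" if "norm z = 1" for z
    using ret that by (auto simp: retraction_def)
  have R_lip: "dist (R x) (R y) \<le> k * dist x y" if "norm x \<le> 1" "norm y \<le> 1" for x y
    using lipschitz_onD[OF lip] that by simp
  have "\<exists>!x. x \<in> cball 0 1 \<and> (- 1 / 4) *\<^sub>R R x = x"
  proof (rule Banach_fix)
    show "complete (cball (0::c0) 1)" by (simp add: complete_eq_closed)
    show "cball (0::c0) 1 \<noteq> {}" by simp
    show "0 \<le> k / 4" "k / 4 < 1" using k0 k4 by auto
    show "(\<lambda>x. (- 1 / 4) *\<^sub>R R x) ` cball 0 1 \<subseteq> cball 0 1"
      using norm_R by auto
    show "\<And>x y. x \<in> cball 0 1 \<Longrightarrow> y \<in> cball 0 1 \<Longrightarrow>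
        dist ((- 1 / 4) *\<^sub>R R x) ((- 1 / 4) *\<^sub>R R y) \<le> k / 4 * dist x y"
      using R_lip by (simp add: dist_norm scaleR_diff_right[symmetric] del: scaleR_minus_left)
  qed
  then obtain x where x1: "norm x \<le> 1" and x: "(- 1 / 4) *\<^sub>R R x = x" by auto
  have x_nth: "c0_nth x n = - (c0_nth (R x) n / 4)" for n
    by (subst x[symmetric]) (simp add: scaleR_c0.rep_eq uminus_c0.rep_eq)
  have x_le: "\<bar>c0_nth x n\<bar> \<le> 1 / 4" for n
    using abs_c0_nth_le_norm[of "R x" n] norm_R[OF x1] by (simp add: x_nth)
  obtain i where i: "\<bar>c0_nth (R x) i\<bar> = 1"
    using c0_norm_attained[of "R x"] norm_R[OF x1] by auto
  define s where "s = c0_nth (R x) i"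
  have s: "\<bar>s\<bar> = 1" using i by (simp add: s_def)
  define y where "y = c0_upd x i (- 3 / 4 * s)"
  define z where "z = c0_upd 0 i (- s)"
  have y1: "norm y \<le> 1"
    using s order_trans[OF abs_c0_nth_le_norm x1]
    by (intro norm_c0_le) (auto simp: y_def c0_upd.rep_eq abs_mult)
  have "norm z \<le> 1"
    using s by (intro norm_c0_le) (auto simp: z_def c0_upd.rep_eq zero_c0.rep_eq)
  moreover have "1 \<le> norm z"
    using abs_c0_nth_le_norm[of z i] s by (simp add: z_def c0_upd.rep_eq)
  ultimately have z1: "norm z = 1" by simp
  have yz: "dist y z \<le> 1 / 4"
    using x_le s by (intro dist_c0_leI) (auto simp: y_def z_def c0_upd.rep_eq zero_c0.rep_eq)
  have xy: "dist x y \<le> 1 / 2"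
    using s by (intro dist_c0_leI) (auto simp: y_def c0_upd.rep_eq x_nth s_def[symmetric])
  have "dist (R y) z \<le> k * dist y z" using R_lip[of y z] R_fix[OF z1] y1 z1 by simp
  also have "\<dots> \<le> k * (1 / 4)" using yz k0 by (rule mult_left_mono)
  finally have "dist (R y) z < 1" using k4 by simp
  then have Ry: "c0_nth (R y) i = - s"
    unfolding z_def using s norm_R[OF y1] by (intro norm_1_near_signed_unit_vector) auto
  have "2 = \<bar>c0_nth (R x) i - c0_nth (R y) i\<bar>" using s by (simp add: Ry s_def[symmetric])
  also have "\<dots> \<le> dist (R x) (R y)" by (rule abs_c0_nth_diff_le_dist)
  also have "\<dots> \<le> k * dist x y" using x1 y1 by (rule R_lip)
  also have "\<dots> \<le> k * (1 / 2)" using xy k0 by (rule mult_left_mono)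
  finally show False using k4 by simp
qed

theorem theorem2p5:
  shows "k0 TYPE(c0) \<ge> 4"
proof -
  have "4 \<le> ereal k" if "4 \<le> k" for k
    using that by (metis ereal_less_eq(3) numeral_eq_ereal)
  then show ?thesis
    unfolding k0_def by (intro Inf_greatest) (auto dest: lipschitz_retraction_c0_ge_4)
qed

end
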